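(* Let $n \geq 3$ be an integer and let $P$ be a bidiophantine $n$-gon such that some side or some diagonal of $P$ has length $4$. Then $n \in \{3, 4\}$.
   Context: Polygons lie in the Euclidean plane $\mathbb{R}^2$ and may be convex or concave. Natural numbers are the positive integers. A polygon is called Diophantine if the distance between every two of its vertices is a natural number. A Diophantine polygon is called bidiophantine if both coordinates of each of its vertices are integers. A diagonal is a segment joining two non-adjacent vertices.
   Formalization: The polygon is additionally assumed to have no three collinear vertices; without this the claim fails, e.g. for the concave pentagon (4,0),(0,3),(-4,0),(0,0),(0,-3), which is bidiophantine and has a side of length 4. *)

theory Defs
  imports "HOL-Analysis.Analysis"
begin

text \<open>
  A polygon is given by the cyclic list of its vertices, and its size is the length of that list.
  It need not be convex.
\<close>

definition adjacent_indices :: "nat \<Rightarrow> nat \<Rightarrow> nat \<Rightarrow> bool" where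
  "adjacent_indices n i j \<longleftrightarrow> i < n \<and> j < n \<and> (j = Suc i mod n \<or> i = Suc j mod n)"

definition side_at :: "(real^2) list \<Rightarrow> nat \<Rightarrow> (real^2) set" where
  "side_at P i = closed_segment (P ! i) (P ! (Suc i mod length P))"

definition side_ends :: "(real^2) list \<Rightarrow> nat \<Rightarrow> (real^2) set" where
  "side_ends P i = {P ! i, P ! (Suc i mod length P)}"

text \<open>
  The vertices are in general position: no three of them are collinear. This is more than asking
  that consecutive vertices be non-collinear; for example, the simple concave closed curve through
  (4,0), (0,3), (-4,0), (0,0), (0,-3) is not a polygon in this sense. (It has integer vertices,
  all distances between them are integers, and it has a side of length 4.)
  The last conjunct says that the boundary is simple: two sides meet at most in a common endpoint.
\<close>

definition polygon :: "(real^2) list \<Rightarrow> bool" where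
  "polygon P \<longleftrightarrow>
     length P \<ge> 3 \<and>
     distinct P \<and>
     (\<forall>a\<in>set P. \<forall>b\<in>set P. \<forall>c\<in>set P.
        a \<noteq> b \<and> a \<noteq> c \<and> b \<noteq> c \<longrightarrow> \<not> collinear {a, b, c}) \<and>
     (\<forall>i<length P. \<forall>j<length P.
        i \<noteq> j \<longrightarrow> side_at P i \<inter> side_at P j \<subseteq> side_ends P i \<inter> side_ends P j)"

definition ngon :: "nat \<Rightarrow> (real^2) list \<Rightarrow> bool" where
  "ngon n P \<longleftrightarrow> polygon P \<and> length P = n"

definition side_of :: "(real^2) list \<Rightarrow> real^2 \<Rightarrow> real^2 \<Rightarrow> bool" where
  "side_of P u v \<longleftrightarrow>
     (\<exists>i j. adjacent_indices (length P) i j \<and> u = P ! i \<and> v = P ! j)"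

definition diagonal_of :: "(real^2) list \<Rightarrow> real^2 \<Rightarrow> real^2 \<Rightarrow> bool" where
  "diagonal_of P u v \<longleftrightarrow>
     (\<exists>i j. i < length P \<and> j < length P \<and> i \<noteq> j \<and> \<not> adjacent_indices (length P) i j \<and>
        u = P ! i \<and> v = P ! j)"

definition diophantine :: "(real^2) list \<Rightarrow> bool" where
  "diophantine P \<longleftrightarrow>
     polygon P \<and>
     (\<forall>u\<in>set P. \<forall>v\<in>set P. u \<noteq> v \<longrightarrow> (\<exists>k::nat. k \<ge> 1 \<and> dist u v = real k))"

definition bidiophantine :: "(real^2) list \<Rightarrow> bool" where
  "bidiophantine P \<longleftrightarrow> diophantine P \<and> (\<forall>v\<in>set P. v $ 1 \<in> \<int> \<and> v $ 2 \<in> \<int>)"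

end

theory Submission
  imports Defs "HOL-Computational_Algebra.Nth_Powers"
begin

text \<open>
  Put the origin at the midpoint of the segment of length 4. By the triangle inequality and a
  parity argument, the distances of any further vertex to the two ends differ by exactly 2, so
  the vertex lies on a hyperbola with these ends as foci, and its coordinates are \<open>(u, 3 z)\<close> with
  \<open>u\<^sup>2 - 3 z\<^sup>2 = 1\<close>. Take two such vertices. If \<open>u\<^sub>1\<close> and \<open>u\<^sub>2\<close> have different parities, the
  squared distance is 2 modulo 4. Otherwise, up to signs, \<open>U = u\<^sub>1 u\<^sub>2 + 3 z\<^sub>1 z\<^sub>2\<close> and
  \<open>V = u\<^sub>1 u\<^sub>2 - 3 z\<^sub>1 z\<^sub>2\<close> are odd positive solutions of the same Pell equation, hence of the form
  \<open>2 s\<^sup>2 - 1 = 6 t\<^sup>2 + 1\<close>. The squared distance is \<open>2 (V - 1) (2 U + 1)\<close> on one branch and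
  \<open>2 (U + 1) (2 V - 1)\<close> across the branches, and this is a square only if the vertices are mirror
  images in an axis. Three vertices cannot pairwise be mirror images in an axis.
\<close>

section \<open>From integral focal distances to the Pell equation\<close>

lemma square_eq_square_plus_4:
  fixes d y :: int
  assumes "d\<^sup>2 = y\<^sup>2 + 4"
  shows "y = 0"
proof (rule ccontr)
  assume "y \<noteq> 0"
  define a b where "a = \<bar>d\<bar>" and "b = \<bar>y\<bar>"
  have ab: "a\<^sup>2 = b\<^sup>2 + 4" "b \<ge> 1" "a \<ge> 0"
    using assms \<open>y \<noteq> 0\<close> by (auto simp: a_def b_def)
  have "a < b + 2"
    by (rule power2_less_imp_less) (use ab in \<open>auto simp: power2_eq_square algebra_simps\<close>)
  moreover have "b < a"
    by (rule power2_less_imp_less) (use ab in auto)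
  ultimately have "a = b + 1" by linarith
  with ab(1) have "2 * b = 3" by algebra
  then show False by presburger
qed

text \<open>Strict triangle inequality for the point \<open>(u, y)\<close>, off the focal axis, and
  the foci \<open>(-2, 0)\<close> and \<open>(2, 0)\<close>. Its failure, squared, would give
  \<open>d2 \<le> u - 2\<close>, but \<open>y \<noteq> 0\<close> makes \<open>d2\<close> exceed
  \<open>u - 2\<close>.\<close>

lemma focal_distances_diff_less:
  fixes u y d1 d2 :: int
  assumes "d2 \<ge> 0" and "d1\<^sup>2 = (u + 2)\<^sup>2 + y\<^sup>2" and "d2\<^sup>2 = (u - 2)\<^sup>2 + y\<^sup>2"
    and "y \<noteq> 0"
  shows "d1 < d2 + 4"
proof (rule ccontr)
  assume "\<not> d1 < d2 + 4"
  then have "(d2 + 4)\<^sup>2 \<le> d1\<^sup>2"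
    using assms(1) by (intro power_mono) auto
  then have "8 * d2 + 16 \<le> 8 * u"
    using assms(2,3) by (simp add: power2_eq_square algebra_simps)
  moreover have "u - 2 < d2"
    by (rule power2_less_imp_less) (use assms in auto)
  ultimately show False by linarith
qed

text \<open>The difference of the focal distances is even and below 4 in absolute value. It is not
  0, since on the perpendicular bisector \<open>y\<^sup>2 + 4\<close> would be a square. A
  difference of 2 either way gives \<open>y\<^sup>2 = 3 * (u\<^sup>2 - 1)\<close>, so 3 divides
  \<open>y\<close>.\<close>

lemma pell_of_focal_distances:
  fixes u y d1 d2 :: int
  assumes d: "d1 \<ge> 0" "d2 \<ge> 0"
    and d1: "d1\<^sup>2 = (u + 2)\<^sup>2 + y\<^sup>2" and d2: "d2\<^sup>2 = (u - 2)\<^sup>2 + y\<^sup>2"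
    and y: "y \<noteq> 0"
  obtains z where "y = 3 * z" "u\<^sup>2 - 3 * z\<^sup>2 = 1" "z \<noteq> 0"
proof -
  have "d1 < d2 + 4"
    using focal_distances_diff_less[OF d(2) d1 d2 y] .
  \<comment> \<open>Reflecting \<open>u\<close> to \<open>-u\<close> exchanges the foci.\<close>
  moreover have "d2 < d1 + 4"
    using focal_distances_diff_less[of d1 d2 "-u" y] d d1 d2 y
    by (simp add: power2_eq_square algebra_simps)
  moreover have "even (d1 - d2)"
  proof -
    have "d1\<^sup>2 - d2\<^sup>2 = 2 * (4 * u)"
      using d1 d2 by algebra
    then have "even (d1\<^sup>2 - d2\<^sup>2)" by simp
    then show ?thesis by simp
  qed
  ultimately have "d1 - d2 = 0 \<or> d1 - d2 = 2 \<or> d1 - d2 = -2" by presburger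
  moreover have "d1 - d2 \<noteq> 0"
  proof
    assume "d1 - d2 = 0"
    then have "8 * u = 0" using d1 d2 by algebra
    then have "u = 0" by simp
    with d1 have "d1\<^sup>2 = y\<^sup>2 + 4" by simp
    then show False using y square_eq_square_plus_4 by blast
  qed
  ultimately have "d1 = d2 + 2 \<or> d2 = d1 + 2" by linarith
  then have hyp: "y\<^sup>2 = 3 * (u\<^sup>2 - 1)"
  proof
    assume e: "d1 = d2 + 2"
    then have "4 * (d2 + 1 - 2 * u) = 0" using d1 d2 by algebra
    then have "d2 = 2 * u - 1" by simp
    then show ?thesis using d2 by algebra
  next
    assume e: "d2 = d1 + 2"
    then have "4 * (d1 + 1 + 2 * u) = 0" using d1 d2 by algebra
    then have "d1 = - 2 * u - 1" by simp
    then show ?thesis using d1 by algebra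
  qed
  then have "3 dvd y\<^sup>2" by simp
  then have "3 dvd y" using prime_dvd_power[of "3::int" y 2] by simp
  then obtain z where z: "y = 3 * z" by (elim dvdE)
  have "3 * (u\<^sup>2 - 3 * z\<^sup>2) = 3 * 1" using hyp z by algebra
  then have "u\<^sup>2 - 3 * z\<^sup>2 = 1" by simp
  then show thesis using that[of z] z y by auto
qed

section \<open>Odd solutions of the Pell equation\<close>

lemma coprime_mult_square_nat:
  fixes a b c :: nat
  assumes "coprime a b" "a * b = c\<^sup>2"
  obtains s t where "a = s\<^sup>2" "b = t\<^sup>2"
proof -
  have "is_nth_power 2 (a * b)" using assms(2) by (simp add: is_nth_power_def)
  show thesis
  proof (cases "a = 0 \<or> b = 0")
    case True
    then have "a = 0 \<and> b = 1 \<or> a = 1 \<and> b = 0" using assms(1) by auto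
    then show thesis using that[of 0 1] that[of 1 0] by auto
  next
    case False
    then have "is_nth_power 2 a" "is_nth_power 2 b"
      using is_nth_power_mult_coprime_natD[OF assms(1) \<open>is_nth_power 2 (a * b)\<close>] by auto
    then show thesis using that by (auto simp: is_nth_power_def)
  qed
qed

text \<open>The factors are coprime, so one is a square and the other three times a square. If 3
  divided \<open>a + 1\<close>, then \<open>a\<close> would be a square congruent to 2 modulo
  3.\<close>

lemma consecutive_product_eq_3_square:
  fixes a c :: nat
  assumes "a * (a + 1) = 3 * c\<^sup>2"
  obtains s t where "a = 3 * t\<^sup>2" "a + 1 = s\<^sup>2"
proof -
  have cop: "coprime a (a + 1)" by simp
  have "prime (3::nat)" by simp
  moreover have "3 dvd a * (a + 1)" using assms by simp
  ultimately consider "3 dvd a" | "3 dvd a + 1"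
    using prime_dvd_mult_iff by blast
  then show thesis
  proof cases
    case 1
    then obtain b where b: "a = 3 * b" by (elim dvdE)
    have "coprime b (a + 1)" using cop b by (metis coprime_mult_left_iff)
    moreover have "b * (a + 1) = c\<^sup>2" using assms b by simp
    ultimately obtain t s where "b = t\<^sup>2" "a + 1 = s\<^sup>2"
      by (rule coprime_mult_square_nat)
    then show thesis using that b by blast
  next
    case 2
    then obtain b where b: "a + 1 = 3 * b" by (elim dvdE)
    have "coprime a b" using cop b by (metis coprime_mult_right_iff)
    moreover have "a * b = c\<^sup>2" using assms unfolding b by simp
    ultimately obtain t where t: "a = t\<^sup>2"
      by (rule coprime_mult_square_nat)
    have "t mod 3 = 0 \<or> t mod 3 = 1 \<or> t mod 3 = 2" by presburger
    then have "t\<^sup>2 mod 3 \<noteq> 2"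
      by (auto simp: power_mod[symmetric, of t 2 3])
    moreover have "a mod 3 = 2" using b by presburger
    ultimately show thesis using t by simp
  qed
qed

text \<open>With \<open>U = 2 * a + 1\<close> and \<open>Z = 2 * c\<close> the equation becomes
  \<open>a * (a + 1) = 3 * c\<^sup>2\<close>, hence \<open>a = 3 * t\<^sup>2\<close> and
  \<open>a + 1 = s\<^sup>2\<close>. Writing \<open>U\<close> through \<open>a\<close> or through
  \<open>a + 1\<close> gives the two forms.\<close>

lemma odd_pell_solution:
  fixes U Z :: int
  assumes "odd U" "U > 0" "U\<^sup>2 - 3 * Z\<^sup>2 = 1"
  obtains s t where "U = 2 * s\<^sup>2 - 1" "U = 6 * t\<^sup>2 + 1"
proof -
  obtain a where a: "U = 2 * a + 1" using assms(1) by (elim oddE)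
  have U2: "U\<^sup>2 = 4 * (a * (a + 1)) + 1" unfolding a by algebra
  have "even Z"
  proof -
    have "3 * Z\<^sup>2 = 2 * (2 * a * (a + 1))" using U2 assms(3) by simp
    then have "even (3 * Z\<^sup>2)" by simp
    then show ?thesis by simp
  qed
  then obtain c where c: "Z = 2 * c" by (elim evenE)
  have "a \<ge> 0" using assms(2) a by linarith
  have "Z\<^sup>2 = 4 * c\<^sup>2" unfolding c by algebra
  then have "4 * (a * (a + 1)) = 4 * (3 * c\<^sup>2)" using U2 assms(3) by linarith
  then have "a * (a + 1) = 3 * c\<^sup>2" by simp
  moreover obtain m where m: "a = int m" using \<open>a \<ge> 0\<close> nonneg_int_cases by blast
  moreover have "c\<^sup>2 = int ((nat \<bar>c\<bar>)\<^sup>2)" by simp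
  ultimately have "int m * (int m + 1) = 3 * int ((nat \<bar>c\<bar>)\<^sup>2)" by metis
  then have "int (m * (m + 1)) = int (3 * (nat \<bar>c\<bar>)\<^sup>2)"
    unfolding of_nat_mult of_nat_add of_nat_numeral of_nat_1 .
  then have "m * (m + 1) = 3 * (nat \<bar>c\<bar>)\<^sup>2" by (rule of_nat_eq_iff[THEN iffD1])
  then obtain s t where st: "m = 3 * t\<^sup>2" "m + 1 = s\<^sup>2"
    by (rule consecutive_product_eq_3_square)
  have "a = 3 * (int t)\<^sup>2" using st(1) m by simp
  moreover have "a + 1 = (int s)\<^sup>2"
    using arg_cong[OF st(2), of int] m by simp
  ultimately show thesis using that[of "int s" "int t"] a by simp
qed

lemma square_cofactor:
  fixes a b d :: int
  assumes "d\<^sup>2 = a\<^sup>2 * b" "a \<noteq> 0"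
  obtains e where "b = e\<^sup>2"
proof -
  have "a\<^sup>2 dvd d\<^sup>2" using assms(1) by simp
  then have "a dvd d" by simp
  then obtain e where "d = a * e" by (elim dvdE)
  then have "a\<^sup>2 * b = a\<^sup>2 * e\<^sup>2" using assms(1) by (simp only: power_mult_distrib)
  then have "b = e\<^sup>2" using assms(2) by simp
  then show thesis by (rule that)
qed

section \<open>Products of solutions in the ring generated by the square root of 3\<close>

lemma pell_product_pos:
  fixes u1 z1 u2 z2 :: int
  assumes "u1\<^sup>2 - 3 * z1\<^sup>2 = 1" "u2\<^sup>2 - 3 * z2\<^sup>2 = 1" "u1 > 0" "u2 > 0"
  shows "u1 * u2 - 3 * (z1 * z2) > 0"
proof -
  \<comment> \<open>For each solution \<open>3 * z\<^sup>2\<close> falls short of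
    \<open>u\<^sup>2\<close> by 1; multiplying the two comparisons bounds the mixed term.\<close>
  have "(3 * (z1 * z2))\<^sup>2 = (3 * z1\<^sup>2) * (3 * z2\<^sup>2)"
    by (simp add: power2_eq_square algebra_simps)
  also have "\<dots> = (u1\<^sup>2 - 1) * (u2\<^sup>2 - 1)" using assms(1,2) by (simp add: algebra_simps)
  also have "\<dots> < u1\<^sup>2 * u2\<^sup>2"
  proof -
    have "u1\<^sup>2 \<ge> 1" "u2\<^sup>2 \<ge> 1" using assms(1,2) by (smt (verit) zero_le_power2)+
    then show ?thesis by (simp add: algebra_simps)
  qed
  also have "\<dots> = (u1 * u2)\<^sup>2" by (simp add: power_mult_distrib)
  finally have less: "(3 * (z1 * z2))\<^sup>2 < (u1 * u2)\<^sup>2" .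
  have "3 * (z1 * z2) < u1 * u2"
    by (rule power2_less_imp_less[OF less]) (use assms(3,4) in simp)
  then show ?thesis by simp
qed

text \<open>The quotient of \<open>u1 + z1 * sqrt 3\<close> by \<open>u2 + z2 * sqrt 3\<close> has
  norm 1 and rational part \<open>u1 * u2 - 3 * (z1 * z2)\<close>. If that part is 1, the irrational
  part vanishes and the quotient is 1.\<close>

lemma pell_product_eq_1:
  fixes u1 z1 u2 z2 :: int
  assumes "u1\<^sup>2 - 3 * z1\<^sup>2 = 1" "u2\<^sup>2 - 3 * z2\<^sup>2 = 1"
    and "u1 * u2 - 3 * (z1 * z2) = 1"
  shows "u1 = u2 \<and> z1 = z2"
proof -
  have "3 * (u1 * z2 - u2 * z1)\<^sup>2
      = (u1 * u2 - 3 * (z1 * z2))\<^sup>2 - (u1\<^sup>2 - 3 * z1\<^sup>2) * (u2\<^sup>2 - 3 * z2\<^sup>2)"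
    by algebra
  then have W: "u1 * z2 = u2 * z1" using assms by simp
  have "u1 = u2" using W assms by algebra
  moreover have "u1 \<noteq> 0" using assms(1) by (smt (verit) zero_le_power2 power_zero_numeral)
  ultimately show ?thesis using W by simp
qed

lemma pell_parity:
  fixes u z :: int
  assumes "u\<^sup>2 - 3 * z\<^sup>2 = 1"
  shows "even z \<longleftrightarrow> odd u"
proof -
  have "odd (u\<^sup>2 - 3 * z\<^sup>2)" using assms by simp
  then show ?thesis by auto
qed

lemma sum_odd_squares_not_square:
  fixes a b d :: int
  assumes "odd a" "odd b"
  shows "d\<^sup>2 \<noteq> a\<^sup>2 + b\<^sup>2"
proof
  assume eq: "d\<^sup>2 = a\<^sup>2 + b\<^sup>2"
  obtain k l where kl: "a = 2 * k + 1" "b = 2 * l + 1" using assms by (elim oddE)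
  have "even (d\<^sup>2)" unfolding eq using assms by simp
  then have "even d" by simp
  then obtain m where "d = 2 * m" by (elim evenE)
  then have "4 * m\<^sup>2 = (2 * k + 1)\<^sup>2 + (2 * l + 1)\<^sup>2" using eq kl by simp
  also have "\<dots> = 4 * (k\<^sup>2 + k + l\<^sup>2 + l) + 2" by algebra
  finally have "4 * m\<^sup>2 = 4 * (k\<^sup>2 + k + l\<^sup>2 + l) + 2" .
  then show False by presburger
qed

text \<open>The expression is the rational part of \<open>u1 + z1 * sqrt 3\<close> times the
  conjugate of \<open>u2 + z2 * sqrt 3\<close>, which again has norm 1. It is odd because
  \<open>u\<close> and \<open>z\<close> have opposite parities in each solution. Replacing
  \<open>z2\<close> by \<open>- z2\<close> covers the product with a plus sign.\<close>

lemma pell_products: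
  fixes u1 z1 u2 z2 :: int
  assumes p1: "u1\<^sup>2 - 3 * z1\<^sup>2 = 1" and p2: "u2\<^sup>2 - 3 * z2\<^sup>2 = 1"
    and pos: "u1 > 0" "u2 > 0" and par: "even u1 \<longleftrightarrow> even u2"
  obtains s t where "u1 * u2 - 3 * (z1 * z2) = 2 * s\<^sup>2 - 1" "u1 * u2 - 3 * (z1 * z2) = 6 * t\<^sup>2 + 1"
proof (rule odd_pell_solution)
  show "odd (u1 * u2 - 3 * (z1 * z2))"
    using pell_parity[OF p1] pell_parity[OF p2] par by auto
  show "u1 * u2 - 3 * (z1 * z2) > 0" by (rule pell_product_pos[OF p1 p2 pos])
  have "(u1 * u2 - 3 * (z1 * z2))\<^sup>2 - 3 * (u1 * z2 - u2 * z1)\<^sup>2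
      = (u1\<^sup>2 - 3 * z1\<^sup>2) * (u2\<^sup>2 - 3 * z2\<^sup>2)"
    by algebra
  then show "(u1 * u2 - 3 * (z1 * z2))\<^sup>2 - 3 * (u1 * z2 - u2 * z1)\<^sup>2 = 1"
    using p1 p2 by simp
qed (use that in blast)

section \<open>Integral distances between two points of the hyperbola\<close>

lemma same_branch:
  fixes u1 z1 u2 z2 d :: int
  assumes p1: "u1\<^sup>2 - 3 * z1\<^sup>2 = 1" and p2: "u2\<^sup>2 - 3 * z2\<^sup>2 = 1"
    and pos: "u1 > 0" "u2 > 0" and par: "even u1 \<longleftrightarrow> even u2"
    and d: "d\<^sup>2 = (u1 - u2)\<^sup>2 + 9 * (z1 - z2)\<^sup>2"
  shows "u1 = u2 \<and> (z1 = z2 \<or> z1 = - z2)"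
proof -
  define U V where "U = u1 * u2 + 3 * (z1 * z2)" and "V = u1 * u2 - 3 * (z1 * z2)"
  obtain e where e: "V = 6 * e\<^sup>2 + 1"
    using pell_products[OF p1 p2 pos par] unfolding V_def by blast
  have p2': "u2\<^sup>2 - 3 * (-z2)\<^sup>2 = 1" using p2 by simp
  have U: "U = u1 * u2 - 3 * (z1 * - z2)" by (simp add: U_def)
  obtain t where t: "U = 6 * t\<^sup>2 + 1"
    using pell_products[OF p1 p2' pos par] unfolding U by blast
  \<comment> \<open>With \<open>u1 = cosh \<alpha>\<close>,
    \<open>sqrt 3 * z1 = sinh \<alpha>\<close> and likewise \<beta> for the second point,
    \<open>U = cosh (\<alpha> + \<beta>)\<close> and \<open>V = cosh (\<alpha> - \<beta>)\<close>;
    the half-angle formulas yield this factorisation. Algebraically, the Pell equations cancel the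
    quartic terms.\<close>
  have "d\<^sup>2 = 2 * (V - 1) * (2 * U + 1)"
  proof -
    have sq: "u1\<^sup>2 = 1 + 3 * z1\<^sup>2" "u2\<^sup>2 = 1 + 3 * z2\<^sup>2" using p1 p2 by simp_all
    have "2 * (V - 1) * (2 * U + 1)
        = 4 * (u1\<^sup>2 * u2\<^sup>2) - 36 * (z1\<^sup>2 * z2\<^sup>2) - 2 * (u1 * u2) - 18 * (z1 * z2) - 2"
      unfolding U_def V_def by algebra
    also have "\<dots> = u1\<^sup>2 + u2\<^sup>2 - 2 * (u1 * u2) + 9 * (z1 - z2)\<^sup>2"
      unfolding sq by algebra
    also have "\<dots> = d\<^sup>2" unfolding d by algebra
    finally show ?thesis by simp
  qed
  also have "\<dots> = (6 * e)\<^sup>2 * (4 * t\<^sup>2 + 1)" unfolding e t by algebra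
  finally have dd: "d\<^sup>2 = (6 * e)\<^sup>2 * (4 * t\<^sup>2 + 1)" .
  \<comment> \<open>Either \<open>e = 0\<close>, so \<open>V = 1\<close> and the points coincide, or
    \<open>4 * t\<^sup>2 + 1\<close> is a square, so \<open>t = 0\<close> and \<open>U = 1\<close>,
    which makes them mirror images in the focal axis.\<close>
  show ?thesis
  proof (cases "e = 0")
    case True
    then have "u1 * u2 - 3 * (z1 * z2) = 1" using e unfolding V_def by simp
    then show ?thesis using pell_product_eq_1[OF p1 p2] by blast
  next
    case False
    then have "6 * e \<noteq> 0" by simp
    then obtain f where "4 * t\<^sup>2 + 1 = f\<^sup>2" by (rule square_cofactor[OF dd])
    then have "(2 * f)\<^sup>2 = (4 * t)\<^sup>2 + 4" by algebra
    then have "4 * t = 0" by (rule square_eq_square_plus_4)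
    then have "u1 * u2 - 3 * (z1 * - z2) = 1" using t unfolding U_def by simp
    then show ?thesis using pell_product_eq_1[OF p1 p2'] by blast
  qed
qed

text \<open>The second point is \<open>(-u2, z2)\<close>, and the conclusion makes it the mirror
  image of the first in the axis between the branches. The factor \<open>2 * V - 1\<close> has to be
  a square, which leaves only \<open>V = 1\<close>.\<close>

lemma opposite_branches:
  fixes u1 z1 u2 z2 d :: int
  assumes p1: "u1\<^sup>2 - 3 * z1\<^sup>2 = 1" and p2: "u2\<^sup>2 - 3 * z2\<^sup>2 = 1"
    and pos: "u1 > 0" "u2 > 0" and par: "even u1 \<longleftrightarrow> even u2"
    and d: "d\<^sup>2 = (u1 + u2)\<^sup>2 + 9 * (z1 - z2)\<^sup>2"
  shows "u1 = u2 \<and> z1 = z2"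
proof -
  define U V where "U = u1 * u2 + 3 * (z1 * z2)" and "V = u1 * u2 - 3 * (z1 * z2)"
  \<comment> \<open>The form with \<open>t\<close> turns \<open>2 * V - 1\<close> into
    \<open>12 * t\<^sup>2 + 1\<close>; comparing the two forms gives
    \<open>e\<^sup>2 = 3 * t\<^sup>2 + 1\<close>.\<close>
  obtain e t where e: "V = 2 * e\<^sup>2 - 1" and t: "V = 6 * t\<^sup>2 + 1"
    using pell_products[OF p1 p2 pos par] unfolding V_def by blast
  have p2': "u2\<^sup>2 - 3 * (-z2)\<^sup>2 = 1" using p2 by simp
  have U: "U = u1 * u2 - 3 * (z1 * - z2)" by (simp add: U_def)
  obtain s where s: "U = 2 * s\<^sup>2 - 1"
    using pell_products[OF p1 p2' pos par] unfolding U by blast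
  have "U > 0" using pell_product_pos[OF p1 p2' pos] by (simp add: U_def)
  then have "s \<noteq> 0" using s by auto
  have "d\<^sup>2 = 2 * (U + 1) * (2 * V - 1)"
  proof -
    have sq: "u1\<^sup>2 = 1 + 3 * z1\<^sup>2" "u2\<^sup>2 = 1 + 3 * z2\<^sup>2" using p1 p2 by simp_all
    have "2 * (U + 1) * (2 * V - 1)
        = 4 * (u1\<^sup>2 * u2\<^sup>2) - 36 * (z1\<^sup>2 * z2\<^sup>2) + 2 * (u1 * u2) - 18 * (z1 * z2) - 2"
      unfolding U_def V_def by algebra
    also have "\<dots> = u1\<^sup>2 + u2\<^sup>2 + 2 * (u1 * u2) + 9 * (z1 - z2)\<^sup>2"
      unfolding sq by algebra
    also have "\<dots> = d\<^sup>2" unfolding d by algebra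
    finally show ?thesis by simp
  qed
  also have "\<dots> = (2 * s)\<^sup>2 * (12 * t\<^sup>2 + 1)" unfolding s t by algebra
  finally have dd: "d\<^sup>2 = (2 * s)\<^sup>2 * (12 * t\<^sup>2 + 1)" .
  have "2 * s \<noteq> 0" using \<open>s \<noteq> 0\<close> by simp
  then obtain f where f: "12 * t\<^sup>2 + 1 = f\<^sup>2" by (rule square_cofactor[OF dd])
  have "e\<^sup>2 = 3 * t\<^sup>2 + 1" using e t by simp
  with f have e4: "4 * e\<^sup>2 = f\<^sup>2 + 3" by simp
  \<comment> \<open>The squares \<open>(2 * e)\<^sup>2\<close> and \<open>f\<^sup>2\<close> differ
    by 3, but for \<open>\<bar>e\<bar> > 1\<close> even the nearest smaller square is
    \<open>4 * \<bar>e\<bar> - 1 > 3\<close> away.\<close>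
  have "t = 0"
  proof (rule ccontr)
    assume "t \<noteq> 0"
    then have "t\<^sup>2 > 0" by simp
    then have "\<bar>e\<bar>\<^sup>2 > 1\<^sup>2" using \<open>e\<^sup>2 = 3 * t\<^sup>2 + 1\<close> by simp
    then have "\<bar>e\<bar> > 1" using power2_less_imp_less abs_ge_zero by blast
    have "\<bar>f\<bar> < 2 * \<bar>e\<bar>"
      by (rule power2_less_imp_less) (use e4 in \<open>auto simp: power_mult_distrib\<close>)
    then have "\<bar>f\<bar>\<^sup>2 \<le> (2 * \<bar>e\<bar> - 1)\<^sup>2" by (intro power_mono) auto
    then have "4 * e\<^sup>2 - 3 \<le> 4 * e\<^sup>2 - 4 * \<bar>e\<bar> + 1"
      using e4 by (simp add: power2_diff power_mult_distrib)
    then show False using \<open>\<bar>e\<bar> > 1\<close> by linarith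
  qed
  then have "u1 * u2 - 3 * (z1 * z2) = 1" using t unfolding V_def by simp
  then show ?thesis by (rule pell_product_eq_1[OF p1 p2])
qed

lemma mirror_images:
  fixes u1 z1 u2 z2 d :: int
  assumes p1: "u1\<^sup>2 - 3 * z1\<^sup>2 = 1" and p2: "u2\<^sup>2 - 3 * z2\<^sup>2 = 1"
    and d: "d\<^sup>2 = (u1 - u2)\<^sup>2 + 9 * (z1 - z2)\<^sup>2"
  shows "(u1 = u2 \<and> (z1 = z2 \<or> z1 = - z2)) \<or> (u1 = - u2 \<and> z1 = z2)"
proof -
  have par: "even u1 \<longleftrightarrow> even u2"
  proof (rule ccontr)
    assume "\<not> ?thesis"
    \<comment> \<open>In each solution \<open>z\<close> has the parity opposite to \<open>u\<close>,
      so both coordinate differences are odd.\<close>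
    then have "odd (u1 - u2)" "odd (3 * (z1 - z2))"
      using pell_parity[OF p1] pell_parity[OF p2] by auto
    moreover have "d\<^sup>2 = (u1 - u2)\<^sup>2 + (3 * (z1 - z2))\<^sup>2"
      using d by algebra
    ultimately show False using sum_odd_squares_not_square by blast
  qed
  have m1: "(-u1)\<^sup>2 - 3 * z1\<^sup>2 = 1" and m2: "(-u2)\<^sup>2 - 3 * z2\<^sup>2 = 1" using p1 p2 by simp_all
  have "u1 \<noteq> 0" "u2 \<noteq> 0"
    using p1 p2 by (smt (verit) zero_le_power2 power_zero_numeral)+
  \<comment> \<open>Changing the sign of \<open>u\<close> preserves the Pell equation, so every sign
    pattern reduces to one of the two branch lemmas.\<close>
  then consider "u1 > 0" "u2 > 0" | "-u1 > 0" "-u2 > 0" | "u1 > 0" "-u2 > 0" | "-u1 > 0" "u2 > 0"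
    by linarith
  then show ?thesis
  proof cases
    case 1
    then show ?thesis using same_branch[OF p1 p2 _ _ par d] by blast
  next
    case 2
    have "d\<^sup>2 = (- u1 - - u2)\<^sup>2 + 9 * (z1 - z2)\<^sup>2"
      using d by algebra
    then show ?thesis using same_branch[OF m1 m2 2] par by simp
  next
    case 3
    have "d\<^sup>2 = (u1 + - u2)\<^sup>2 + 9 * (z1 - z2)\<^sup>2" using d by simp
    then show ?thesis using opposite_branches[OF p1 m2 3] par by simp
  next
    case 4
    have "d\<^sup>2 = (- u1 + u2)\<^sup>2 + 9 * (z1 - z2)\<^sup>2" using d by algebra
    then have "- u1 = u2 \<and> z1 = z2" using opposite_branches[OF m1 p2 4] par by simp
    then show ?thesis by auto
  qed
qed

section \<open>Coordinates in the plane and the count of vertices\<close>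

lemma dist_square_real2:
  fixes x y :: "real^2" and i j :: 2
  assumes "i \<noteq> j"
  shows "(dist x y)\<^sup>2 = (x $ i - y $ i)\<^sup>2 + (x $ j - y $ j)\<^sup>2"
proof -
  have "(i = 1 \<and> j = 2) \<or> (i = 2 \<and> j = 1)" using assms by (metis exhaust_2)
  then show ?thesis
    by (auto simp: dist_norm power2_norm_eq_inner inner_vec_def sum_2 power2_eq_square[of "_ $ _ - _"])
qed

lemma collinear_coordinate_line:
  fixes S :: "(real^2) set" and i j :: 2
  assumes "i \<noteq> j" and "\<And>x. x \<in> S \<Longrightarrow> x $ j = c"
  shows "collinear S"
  unfolding collinear_def
proof (intro exI ballI)
  fix x y assume xy: "x \<in> S" "y \<in> S"
  have "k = i \<or> k = j" for k :: 2 using assms(1) by (metis exhaust_2)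
  then show "x - y = (x $ i - y $ i) *\<^sub>R axis i 1"
    using assms xy by (auto simp: vec_eq_iff axis_def)
qed

text \<open>Here \<open>i\<close> is the direction of the segment and \<open>j\<close> the one
  across it, so a single argument serves segments parallel to either axis.\<close>

lemma at_most_two_further_points:
  fixes A B :: "real^2" and S :: "(real^2) set" and i j :: 2
  assumes ij: "i \<noteq> j" and AB: "A $ j = B $ j" "B $ i = A $ i + 4"
    and mem: "A \<in> S" "B \<in> S"
    and ints: "\<And>x k. x \<in> S \<Longrightarrow> x $ k \<in> \<int>"
    and dists: "\<And>x y. x \<in> S \<Longrightarrow> y \<in> S \<Longrightarrow> x \<noteq> y \<Longrightarrow> \<exists>k::nat. dist x y = real k"
    and gen: "\<And>x. x \<in> S \<Longrightarrow> x \<noteq> A \<Longrightarrow> x \<noteq> B \<Longrightarrow> \<not> collinear {A, B, x}"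
    and T: "p \<in> S - {A, B}" "q \<in> S - {A, B}" "r \<in> S - {A, B}"
    and distinct: "p \<noteq> q" "q \<noteq> r" "p \<noteq> r"
  shows False
proof -
  \<comment> \<open>The shift by 2 moves the origin to the midpoint of the segment.\<close>
  define loc where "loc w u z \<longleftrightarrow> w $ i = A $ i + 2 + of_int u \<and> w $ j = A $ j + 3 * of_int z \<and>
      u\<^sup>2 - 3 * z\<^sup>2 = 1 \<and> z \<noteq> 0" for w :: "real^2" and u z :: int
  have ex_loc: "\<exists>u z. loc w u z" if w: "w \<in> S - {A, B}" for w
  proof -
    have "w $ i - A $ i - 2 \<in> \<int>" "w $ j - A $ j \<in> \<int>"
      using ints w mem by (auto intro!: Ints_diff)
    then obtain u y where u: "w $ i - A $ i - 2 = of_int u" and y: "w $ j - A $ j = of_int y"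
      by (meson Ints_cases)
    obtain d1 d2 :: nat where d1: "dist w A = real d1" and d2: "dist w B = real d2"
      using dists[of w A] dists[of w B] w mem by auto
    have wi: "w $ i - A $ i = of_int (u + 2)" "w $ i - B $ i = of_int (u - 2)"
      "w $ j - B $ j = of_int y" using u y AB by simp_all
    have "real_of_int ((int d1)\<^sup>2) = of_int ((u + 2)\<^sup>2 + y\<^sup>2)"
      using dist_square_real2[OF ij, of w A] unfolding d1 wi y by simp
    then have e1: "(int d1)\<^sup>2 = (u + 2)\<^sup>2 + y\<^sup>2" by (simp only: of_int_eq_iff)
    have "real_of_int ((int d2)\<^sup>2) = of_int ((u - 2)\<^sup>2 + y\<^sup>2)"
      using dist_square_real2[OF ij, of w B] unfolding d2 wi y by simp
    then have e2: "(int d2)\<^sup>2 = (u - 2)\<^sup>2 + y\<^sup>2" by (simp only: of_int_eq_iff)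
    \<comment> \<open>General position enters here: \<open>w\<close> is off the line through
      \<open>A\<close> and \<open>B\<close>.\<close>
    have "y \<noteq> 0"
    proof
      assume "y = 0"
      then have "collinear {A, B, w}"
        using y AB by (intro collinear_coordinate_line[OF ij, of _ "A $ j"]) auto
      then show False using gen w by auto
    qed
    then obtain z where "y = 3 * z" "u\<^sup>2 - 3 * z\<^sup>2 = 1" "z \<noteq> 0"
      using pell_of_focal_distances[OF _ _ e1 e2] by auto
    then have "loc w u z" using u y by (simp add: loc_def)
    then show ?thesis by blast
  qed
  have mirror: "(u1 = u2 \<and> z1 = - z2) \<or> (u1 = - u2 \<and> z1 = z2)"
    if "w1 \<in> S" "w2 \<in> S" "w1 \<noteq> w2" and a: "loc w1 u1 z1" "loc w2 u2 z2" for w1 w2 u1 z1 u2 z2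
  proof -
    obtain d :: nat where d: "dist w1 w2 = real d" using dists \<open>w1 \<in> S\<close> \<open>w2 \<in> S\<close> \<open>w1 \<noteq> w2\<close> by blast
    have diffs: "w1 $ i - w2 $ i = of_int (u1 - u2)" "w1 $ j - w2 $ j = of_int (3 * (z1 - z2))"
      using a by (simp_all add: loc_def)
    have "real_of_int ((int d)\<^sup>2) = of_int ((u1 - u2)\<^sup>2 + (3 * (z1 - z2))\<^sup>2)"
      using dist_square_real2[OF ij, of w1 w2] unfolding d diffs by simp
    then have "(int d)\<^sup>2 = (u1 - u2)\<^sup>2 + (3 * (z1 - z2))\<^sup>2" by (simp only: of_int_eq_iff)
    then have "(int d)\<^sup>2 = (u1 - u2)\<^sup>2 + 9 * (z1 - z2)\<^sup>2" by algebra
    then have "(u1 = u2 \<and> (z1 = z2 \<or> z1 = - z2)) \<or> (u1 = - u2 \<and> z1 = z2)"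
      using mirror_images a unfolding loc_def by blast
    moreover have "\<not> (u1 = u2 \<and> z1 = z2)"
    proof
      assume "u1 = u2 \<and> z1 = z2"
      then have "dist w1 w2 = 0"
        using dist_square_real2[OF ij, of w1 w2] unfolding diffs by simp
      then show False using \<open>w1 \<noteq> w2\<close> by simp
    qed
    ultimately show ?thesis by blast
  qed
  obtain u1 z1 u2 z2 u3 z3 where a: "loc p u1 z1" "loc q u2 z2" "loc r u3 z3"
    using ex_loc T by meson
  have "u1 \<noteq> 0"
    using a(1) by (smt (verit) loc_def zero_le_power2 power_zero_numeral)
  moreover have "z1 \<noteq> 0" using a(1) by (simp add: loc_def)
  \<comment> \<open>Two mirror steps from \<open>p\<close> through \<open>q\<close> to
    \<open>r\<close> lead to \<open>(u1, z1)\<close> or \<open>(-u1, -z1)\<close>. Neither is a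
    mirror image of \<open>(u1, z1)\<close> in an axis, as \<open>u1\<close> and \<open>z1\<close>
    are nonzero.\<close>
  ultimately show False
    using mirror[OF _ _ distinct(1) a(1,2)] mirror[OF _ _ distinct(2) a(2,3)]
      mirror[OF _ _ distinct(3) a(1,3)] T by auto
qed

text \<open>This forces a lattice segment of length 4 to be parallel to a coordinate axis. Both
  entries are at most 4 in absolute value, which leaves a finite check.\<close>

lemma sum_squares_eq_16:
  fixes a b :: int
  assumes "a\<^sup>2 + b\<^sup>2 = 16"
  shows "(b = 0 \<and> (a = 4 \<or> a = -4)) \<or> (a = 0 \<and> (b = 4 \<or> b = -4))"
proof -
  have "\<bar>a\<bar>\<^sup>2 \<le> 4\<^sup>2" "\<bar>b\<bar>\<^sup>2 \<le> 4\<^sup>2"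
    using assms by (simp_all, smt (verit) zero_le_power2)+
  then have "\<bar>a\<bar> \<le> 4" "\<bar>b\<bar> \<le> 4" by (metis power2_le_imp_le zero_le_numeral)+
  then have "a \<in> {-4..4}" "b \<in> {-4..4}" by auto
  moreover have "{-4..4::int} = {-4,-3,-2,-1,0,1,2,3,4}" by auto
  ultimately show ?thesis using assms by auto
qed

theorem mainTheorem4:
  fixes n :: nat and P :: "(real^2) list"
  assumes "n \<ge> 3"
    and "ngon n P"
    and "bidiophantine P"
    and "\<exists>u v. (side_of P u v \<or> diagonal_of P u v) \<and> dist u v = 4"
  shows "n \<in> {3, 4}"
proof (rule ccontr)
  assume "n \<notin> {3, 4}"
  with assms(1) have n: "n \<ge> 5" by auto
  have poly: "polygon P" and len: "length P = n" using assms(2) by (auto simp: ngon_def)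
  obtain A B where AB: "side_of P A B \<or> diagonal_of P A B" and d: "dist A B = 4"
    using assms(4) by blast
  have mem: "A \<in> set P" "B \<in> set P"
    using AB by (auto simp: side_of_def diagonal_of_def adjacent_indices_def)
  have ints: "x $ k \<in> \<int>" if "x \<in> set P" for x k
    using assms(3) that exhaust_2[of k] by (auto simp: bidiophantine_def)
  have dists: "\<exists>k::nat. dist x y = real k" if "x \<in> set P" "y \<in> set P" "x \<noteq> y" for x y
    using assms(3) that unfolding bidiophantine_def diophantine_def by blast
  have "A \<noteq> B" using d by auto
  have gen: "\<not> collinear {A, B, x}" if "x \<in> set P" "x \<noteq> A" "x \<noteq> B" for x
    using poly mem that \<open>A \<noteq> B\<close> unfolding polygon_def by metis
  have "card (set P) = n" using poly len by (simp add: polygon_def distinct_card)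
  \<comment> \<open>At least five vertices leave three besides \<open>A\<close> and
    \<open>B\<close>.\<close>
  then have "3 \<le> card (set P - {A, B})"
    using n mem \<open>A \<noteq> B\<close> by (simp add: card_Diff_subset)
  then obtain T where T: "T \<subseteq> set P - {A, B}" "card T = 3"
    by (meson obtain_subset_with_card_n)
  then obtain p q r where T3: "T = {p, q, r}" "p \<noteq> q" "q \<noteq> r" "p \<noteq> r"
    by (auto simp: card_3_iff)
  have pqr: "p \<in> set P - {A, B}" "q \<in> set P - {A, B}" "r \<in> set P - {A, B}"
    using T T3 by auto
  have axis_parallel: False if "i \<noteq> j" "A $ j = B $ j" "B $ i = A $ i + 4" for i j :: 2
    by (rule at_most_two_further_points[of i j A B "set P" p q r])
       (use that mem ints dists gen pqr T3 in auto)
  \<comment> \<open>Exchanging \<open>A\<close> and \<open>B\<close> handles the segment traversed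
    in the negative direction.\<close>
  have axis_parallel': False if "i \<noteq> j" "A $ j = B $ j" "A $ i = B $ i + 4" for i j :: 2
    by (rule at_most_two_further_points[of i j B A "set P" p q r])
       (use that mem ints dists gen pqr T3 in \<open>auto simp: insert_commute\<close>)
  obtain a b where a: "B $ 1 - A $ 1 = of_int a" and b: "B $ 2 - A $ 2 = of_int b"
    using ints mem by (meson Ints_cases Ints_diff)
  have "(dist B A)\<^sup>2 = 16" using d by (simp add: dist_commute)
  then have "real_of_int (a\<^sup>2 + b\<^sup>2) = of_int 16"
    using dist_square_real2[of 1 2 B A] unfolding a b by simp
  then have "a\<^sup>2 + b\<^sup>2 = 16" by (simp only: of_int_eq_iff)
  then consider "b = 0" "a = 4" | "b = 0" "a = -4" | "a = 0" "b = 4" | "a = 0" "b = -4"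
    using sum_squares_eq_16 by blast
  then show False
  proof cases
    case 1 then show False using a b axis_parallel[of 1 2] by simp
  next
    case 2 then show False using a b axis_parallel'[of 1 2] by simp
  next
    case 3 then show False using a b axis_parallel[of 2 1] by simp
  next
    case 4 then show False using a b axis_parallel'[of 2 1] by simp
  qed
qed

end
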